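(* Any nonempty interval of subTuring degrees contains an antichain of continuum many degrees: if $g,f\colon\subseteq\omega\to\omega$ are partial functions with $g<_{\rm subT} f$, then there is a family $\{h_\alpha\}_{\alpha<2^{\aleph_0}}$ of partial functions such that $g<_{\rm subT} h_\alpha<_{\rm subT} f$ for every $\alpha$, and $h_\alpha\not\leq_{\rm subT} h_\beta$ whenever $\alpha\neq\beta$.
   Context: For a partial computable function $\Phi$ from finite sequences of natural numbers to $\{0,1\}\times\omega$ and a partial function $g\colon\subseteq\omega\to\omega$, the $g$-relative sequential computation $\Phi[g]$ is defined as follows. On input $n$, with oracle answers $a_0,\dots,a_{s-1}$ obtained so far: if $\Phi(n,a_0,\dots,a_{s-1})$ is undefined, $\Phi[g](n)$ is undefined; if it equals $\langle 1,q\rangle$ the computation halts with output $q$; if it equals $\langle 0,q\rangle$, $q$ is a query, and if $q\in{\rm dom}(g)$ the computation continues with $a_s=g(q)$, while if $q\notin{\rm dom}(g)$ the computation never halts. For partial $f,g$, $f\leq_{\rm subT} g$ means there is such $\Phi$ with $f\subseteq\Phi[g]$. $f<_{\rm subT} g$ means $f\leq_{\rm subT} g$ and $g\not\leq_{\rm subT} f$. *)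

theory Defs
  imports Main "HOL-Library.Nat_Bijection"
begin

datatype recf =
    Zero
  | Succ
  | Proj nat
  | Comp recf "recf list"
  | PrimRec recf recf
  | Mu recf

text \<open>
  Arities are not tracked: a term denotes a \<open>k\<close>-ary partial recursive function for every
  \<open>k\<close>, read off from the argument lists of length \<open>k\<close> (undefined where the shape does not fit).
  Composition is strict, and \<open>Mu r\<close> requires the values at all arguments below the least zero
  to be defined.
\<close>

fun eval_recf :: "recf \<Rightarrow> nat list \<Rightarrow> nat option" where
  "eval_recf Zero xs = Some 0"
| "eval_recf Succ xs = (case xs of [x] \<Rightarrow> Some (Suc x) | _ \<Rightarrow> None)"
| "eval_recf (Proj i) xs = (if i < length xs then Some (xs ! i) else None)"
| "eval_recf (Comp r rs) xs =
     (if \<forall>s\<in>set rs. eval_recf s xs \<noteq> None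
      then eval_recf r (map (\<lambda>s. the (eval_recf s xs)) rs) else None)"
| "eval_recf (PrimRec r s) xs =
     (case xs of
        [] \<Rightarrow> None
      | n # ys \<Rightarrow>
          rec_nat (eval_recf r ys)
            (\<lambda>m v. case v of None \<Rightarrow> None | Some y \<Rightarrow> eval_recf s (m # y # ys)) n)"
| "eval_recf (Mu r) xs =
     (if \<exists>n. eval_recf r (n # xs) = Some 0 \<and> (\<forall>m<n. eval_recf r (m # xs) \<noteq> None)
      then Some (LEAST n. eval_recf r (n # xs) = Some 0) else None)"

text \<open>
  Finite sequences and pairs are coded by the standard bijections of \<open>Nat_Bijection\<close>;
  the set \<open>{0, 1}\<close> is represented by \<^typ>\<open>bool\<close>, with \<open>True\<close> for \<open>1\<close>.
\<close>

definition partial_computable :: "(nat list \<Rightarrow> (bool \<times> nat) option) \<Rightarrow> bool" where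
  "partial_computable \<Phi> \<longleftrightarrow>
     (\<exists>r. \<forall>xs. eval_recf r [list_encode xs] =
        map_option (\<lambda>(b, q). prod_encode (of_bool b, q)) (\<Phi> xs))"

text \<open>
  The argument \<open>xs\<close> of \<open>run\<close> is the sequence \<open>n, a\<^sub>0, \<dots>, a\<^bsub>s-1\<^esub>\<close> of the input and the
  answers received so far. As a least fixed point in \<open>option\<close>, \<open>run\<close> is \<open>None\<close> on
  infinite computations.
\<close>

partial_function (option) run ::
  "(nat list \<Rightarrow> (bool \<times> nat) option) \<Rightarrow> (nat \<Rightarrow> nat option) \<Rightarrow> nat list \<Rightarrow> nat option"
where
  "run \<Phi> g xs =
     (case \<Phi> xs of
        None \<Rightarrow> None
      | Some (halt, q) \<Rightarrow>
          if halt then Some q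
          else (case g q of None \<Rightarrow> None | Some a \<Rightarrow> run \<Phi> g (xs @ [a])))"

definition seq_computation ::
  "(nat list \<Rightarrow> (bool \<times> nat) option) \<Rightarrow> (nat \<Rightarrow> nat option) \<Rightarrow> nat \<Rightarrow> nat option"
where
  "seq_computation \<Phi> g n = run \<Phi> g [n]"

definition subT_le :: "(nat \<Rightarrow> nat option) \<Rightarrow> (nat \<Rightarrow> nat option) \<Rightarrow> bool"
  (infix "\<le>\<^sub>s\<^sub>u\<^sub>b\<^sub>T" 50) where
  "f \<le>\<^sub>s\<^sub>u\<^sub>b\<^sub>T g \<longleftrightarrow> (\<exists>\<Phi>. partial_computable \<Phi> \<and> f \<subseteq>\<^sub>m seq_computation \<Phi> g)"

definition subT_less :: "(nat \<Rightarrow> nat option) \<Rightarrow> (nat \<Rightarrow> nat option) \<Rightarrow> bool"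
  (infix "<\<^sub>s\<^sub>u\<^sub>b\<^sub>T" 50) where
  "f <\<^sub>s\<^sub>u\<^sub>b\<^sub>T g \<longleftrightarrow> f \<le>\<^sub>s\<^sub>u\<^sub>b\<^sub>T g \<and> \<not> g \<le>\<^sub>s\<^sub>u\<^sub>b\<^sub>T f"

end

theory Submission
  imports Defs "HOL-Library.Countable_Set"
begin

text \<open>
  Each \<open>h\<^sub>\<alpha>\<close> is the join of \<open>g\<close> with a restriction of \<open>f\<close> to a set \<open>A\<^sub>\<alpha>\<close>. If \<open>f |` A\<^sub>\<alpha>\<close> is not
  reducible to \<open>h\<^sub>\<beta>\<close> for \<open>\<alpha> \<noteq> \<beta>\<close>, then all the required strict inequalities follow. The sets are
  built by finite conditions along a perfect tree. Given conditions \<open>p\<close>, \<open>q\<close> for two of the sets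
  and a functional \<open>\<Phi>\<close>, some \<open>n\<close> in the domain of \<open>f\<close> undecided by \<open>p\<close> is computed incorrectly by
  \<open>\<Phi>\<close> from \<open>g\<close> and the finitely many values of \<open>f\<close> granted by \<open>q\<close>: otherwise \<open>f\<close> would reduce to \<open>g\<close>
  by hard-coding finite tables. Put \<open>n\<close> into the first set. If \<open>\<Phi>\<close> converges to a wrong value, it
  does so for every larger oracle. If it diverges but a larger oracle could cure this, then it is
  stuck at a single query, which is kept out of the second set.
\<close>

section \<open>Closure properties of partial recursive functions\<close>

text \<open>Agreement is asked only on lists of length \<open>k\<close>; this restores the arity
  that \<open>recf\<close> leaves open.\<close>

definition recursive_on :: "nat \<Rightarrow> (nat list \<Rightarrow> nat option) \<Rightarrow> bool" where
  "recursive_on k F \<longleftrightarrow> (\<exists>r. \<forall>xs. length xs = k \<longrightarrow> eval_recf r xs = F xs)"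

abbreviation total_recursive_on :: "nat \<Rightarrow> (nat list \<Rightarrow> nat) \<Rightarrow> bool" where
  "total_recursive_on k h \<equiv> recursive_on k (\<lambda>xs. Some (h xs))"

named_theorems recursive_intros

lemma recursive_on_cong:
  assumes "recursive_on k F" and "\<And>xs. length xs = k \<Longrightarrow> F xs = G xs"
  shows "recursive_on k G"
  using assms unfolding recursive_on_def by metis

lemma recursive_on_nth [recursive_intros]:
  "i < k \<Longrightarrow> total_recursive_on k (\<lambda>xs. xs ! i)"
  unfolding recursive_on_def by (rule exI[of _ "Proj i"]) simp

lemma recursive_on_comp:
  assumes F: "recursive_on (length Gs) F" and Gs: "\<And>G. G \<in> set Gs \<Longrightarrow> recursive_on k G"
  shows "recursive_on k (\<lambda>xs. if \<forall>G\<in>set Gs. G xs \<noteq> None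
           then F (map (\<lambda>G. the (G xs)) Gs) else None)"
proof -
  obtain r where r: "\<And>ys. length ys = length Gs \<Longrightarrow> eval_recf r ys = F ys"
    using F unfolding recursive_on_def by blast
  obtain R where R: "\<And>G xs. G \<in> set Gs \<Longrightarrow> length xs = k \<Longrightarrow> eval_recf (R G) xs = G xs"
    using Gs unfolding recursive_on_def by metis
  have "eval_recf (Comp r (map R Gs)) xs =
      (if \<forall>G\<in>set Gs. G xs \<noteq> None then F (map (\<lambda>G. the (G xs)) Gs) else None)"
    if "length xs = k" for xs
  proof -
    have "map (\<lambda>s. the (eval_recf s xs)) (map R Gs) = map (\<lambda>G. the (G xs)) Gs"
      using R that by simp
    then show ?thesis
      using R that r by (auto simp del: map_map)
  qed
  then show ?thesis unfolding recursive_on_def by blast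
qed

text \<open>Composition in monadic form: projections pass on the old arguments, and the new value is
  put in front of them.\<close>

lemma recursive_on_bind:
  assumes "recursive_on k G" and "recursive_on (Suc k) F"
  shows "recursive_on k (\<lambda>xs. Option.bind (G xs) (\<lambda>y. F (y # xs)))"
proof (rule recursive_on_cong)
  let ?Gs = "G # map (\<lambda>i xs. Some (xs ! i)) [0..<k]"
  show "recursive_on k (\<lambda>xs. if \<forall>G\<in>set ?Gs. G xs \<noteq> None
           then F (map (\<lambda>G. the (G xs)) ?Gs) else None)"
    using assms by (intro recursive_on_comp) (auto intro: recursive_on_nth)
  show "(if \<forall>G\<in>set ?Gs. G xs \<noteq> None then F (map (\<lambda>G. the (G xs)) ?Gs) else None) =
      Option.bind (G xs) (\<lambda>y. F (y # xs))" if "length xs = k" for xs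
    using that by (auto simp: comp_def split: bind_splits)
      (metis map_nth)+
qed

lemma recursive_on_drop:
  assumes "recursive_on k F"
  shows "recursive_on (m + k) (\<lambda>xs. F (drop m xs))"
proof (rule recursive_on_cong)
  let ?Gs = "map (\<lambda>i xs. Some (xs ! i)) [m..<m + k]"
  show "recursive_on (m + k) (\<lambda>xs. if \<forall>G\<in>set ?Gs. G xs \<noteq> None
           then F (map (\<lambda>G. the (G xs)) ?Gs) else None)"
    using assms by (intro recursive_on_comp) (auto intro: recursive_on_nth)
  show "(if \<forall>G\<in>set ?Gs. G xs \<noteq> None then F (map (\<lambda>G. the (G xs)) ?Gs) else None) =
      F (drop m xs)" if "length xs = m + k" for xs
  proof -
    have "map (\<lambda>i. xs ! i) [m..<m + k] = drop m xs"
      using that by (intro nth_equalityI) auto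
    then show ?thesis by (auto simp: comp_def)
  qed
qed

lemma recursive_on_app:
  assumes "recursive_on 1 F" and "total_recursive_on k a"
  shows "recursive_on k (\<lambda>xs. F [a xs])"
  using recursive_on_comp[of "[\<lambda>xs. Some (a xs)]" F k] assms by simp

lemma total_recursive_on_app1:
  assumes "total_recursive_on 1 (\<lambda>xs. h (xs ! 0))" and "total_recursive_on k a"
  shows "total_recursive_on k (\<lambda>xs. h (a xs))"
  using recursive_on_app[OF assms] by simp

lemma recursive_on_rec_nat:
  assumes "recursive_on k F" and "recursive_on (Suc (Suc k)) G"
  shows "recursive_on (Suc k) (\<lambda>xs. rec_nat (F (tl xs))
           (\<lambda>m v. Option.bind v (\<lambda>y. G (m # y # tl xs))) (hd xs))"
proof -
  obtain r s where r: "\<And>xs. length xs = k \<Longrightarrow> eval_recf r xs = F xs"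
    and s: "\<And>xs. length xs = Suc (Suc k) \<Longrightarrow> eval_recf s xs = G xs"
    using assms unfolding recursive_on_def by metis
  have "eval_recf (PrimRec r s) xs = rec_nat (F (tl xs))
           (\<lambda>m v. Option.bind v (\<lambda>y. G (m # y # tl xs))) (hd xs)"
    if xs: "length xs = Suc k" for xs
  proof -
    obtain n ys where [simp]: "xs = n # ys" and ys: "length ys = k"
      using xs by (cases xs) auto
    have "rec_nat (eval_recf r ys)
        (\<lambda>m v. case v of None \<Rightarrow> None | Some y \<Rightarrow> eval_recf s (m # y # ys)) n =
      rec_nat (F ys) (\<lambda>m v. Option.bind v (\<lambda>y. G (m # y # ys))) n"
      by (induction n) (auto simp: r s ys split: option.splits)
    then show ?thesis by simp
  qed
  then show ?thesis unfolding recursive_on_def by blast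
qed

lemma rec_nat_Some:
  "rec_nat (Some b) (\<lambda>m v. Option.bind v (\<lambda>y. Some (s m y))) n = Some (rec_nat b s n)"
  by (induction n) auto

lemma total_recursive_on_rec_nat:
  assumes "total_recursive_on k b" and "total_recursive_on (Suc (Suc k)) s"
    and "total_recursive_on k n"
  shows "total_recursive_on k (\<lambda>xs. rec_nat (b xs) (\<lambda>m y. s (m # y # xs)) (n xs))"
  using recursive_on_bind[OF assms(3) recursive_on_rec_nat[OF assms(1,2)]]
  by (simp add: rec_nat_Some)

lemma recursive_on_Mu:
  assumes "recursive_on (Suc k) F"
  shows "recursive_on k (\<lambda>xs.
     if \<exists>n. F (n # xs) = Some 0 \<and> (\<forall>m<n. F (m # xs) \<noteq> None)
     then Some (LEAST n. F (n # xs) = Some 0) else None)"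
proof -
  obtain r where r: "\<And>xs. length xs = Suc k \<Longrightarrow> eval_recf r xs = F xs"
    using assms unfolding recursive_on_def by metis
  show ?thesis
    unfolding recursive_on_def
  proof (intro exI allI impI)
    fix xs :: "nat list"
    assume "length xs = k"
    then have "eval_recf r (n # xs) = F (n # xs)" for n by (simp add: r)
    then show "eval_recf (Mu r) xs = (if \<exists>n. F (n # xs) = Some 0 \<and> (\<forall>m<n. F (m # xs) \<noteq> None)
        then Some (LEAST n. F (n # xs) = Some 0) else None)"
      by (simp only: eval_recf.simps)
  qed
qed

section \<open>Arithmetic and the pairing function\<close>

lemma total_recursive_on_Suc [recursive_intros]:
  assumes "total_recursive_on k a"
  shows "total_recursive_on k (\<lambda>xs. Suc (a xs))"
proof -
  have "recursive_on 1 (\<lambda>xs. Some (Suc (xs ! 0)))"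
    unfolding recursive_on_def by (rule exI[of _ Succ]) (auto simp: length_Suc_conv)
  from total_recursive_on_app1[OF this assms] show ?thesis .
qed

lemma total_recursive_on_const [recursive_intros]: "total_recursive_on k (\<lambda>_. c)"
proof (induction c)
  case 0
  show ?case unfolding recursive_on_def by (rule exI[of _ Zero]) simp
qed (rule total_recursive_on_Suc)

lemma total_recursive_on_add [recursive_intros]:
  assumes "total_recursive_on k a" and "total_recursive_on k b"
  shows "total_recursive_on k (\<lambda>xs. a xs + b xs)"
proof -
  have "rec_nat x (\<lambda>m y. Suc y) n = n + x" for x n :: nat
    by (induction n) auto
  then show ?thesis
    using total_recursive_on_rec_nat[of k b "\<lambda>ys. Suc (ys ! 1)" a] assms
    by (simp add: recursive_intros)
qed

lemma total_recursive_on_if [recursive_intros]: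
  assumes "total_recursive_on k c" and "total_recursive_on k a" and "total_recursive_on k b"
  shows "total_recursive_on k (\<lambda>xs. if c xs = 0 then a xs else b xs)"
proof -
  have "rec_nat x (\<lambda>m _. z) n = (if n = 0 then x else z)" for x z n :: nat
    by (cases n) auto
  then show ?thesis
    using total_recursive_on_rec_nat[of k a "\<lambda>ys. b (drop 2 ys)" c]
      assms recursive_on_drop[OF assms(3), of 2]
    by simp
qed

lemma total_recursive_on_diff [recursive_intros]:
  assumes "total_recursive_on k a" and "total_recursive_on k b"
  shows "total_recursive_on k (\<lambda>xs. a xs - b xs)"
proof -
  \<comment> \<open>Predecessor: the step returns the index \<open>m\<close> of the last round.
    Truncated subtraction then iterates it.\<close>
  have "rec_nat 0 (\<lambda>m y. m) n = n - 1" for n :: nat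
    by (cases n) auto
  then have pred: "total_recursive_on j (\<lambda>xs. c xs - 1)" if "total_recursive_on j c" for j c
    using total_recursive_on_rec_nat[of j "\<lambda>_. 0" "\<lambda>ys. ys ! 0" c] that
    by (simp add: recursive_intros)
  have "rec_nat x (\<lambda>m y. y - 1) n = x - n" for x n :: nat
    by (induction n) auto
  then show ?thesis
    using total_recursive_on_rec_nat[of k a "\<lambda>ys. ys ! 1 - 1" b] assms
      pred[OF recursive_on_nth[of 1 "Suc (Suc k)"]]
    by simp
qed

lemma total_recursive_on_triangle [recursive_intros]:
  assumes "total_recursive_on k a"
  shows "total_recursive_on k (\<lambda>xs. triangle (a xs))"
proof -
  have "rec_nat 0 (\<lambda>m y. y + Suc m) n = triangle n" for n
    by (induction n) auto
  then show ?thesis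
    using total_recursive_on_rec_nat[of k "\<lambda>_. 0" "\<lambda>ys. ys ! 1 + Suc (ys ! 0)" a] assms
    by (simp add: recursive_intros del: add_Suc_right)
qed

lemma total_recursive_on_prod_encode [recursive_intros]:
  assumes "total_recursive_on k a" and "total_recursive_on k b"
  shows "total_recursive_on k (\<lambda>xs. prod_encode (a xs, b xs))"
  using assms by (simp add: prod_encode_def recursive_intros)

section \<open>Projections of coded pairs\<close>

abbreviation code_fst :: "nat \<Rightarrow> nat" where
  "code_fst n \<equiv> fst (prod_decode n)"

abbreviation code_snd :: "nat \<Rightarrow> nat" where
  "code_snd n \<equiv> snd (prod_decode n)"

lemma triangle_mono: "m \<le> n \<Longrightarrow> triangle m \<le> triangle n"
  by (induction n) (auto simp: le_Suc_eq)

text \<open>The Cantor code of \<open>(a, b)\<close> is \<open>triangle (a + b) + a\<close>, hence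
  below the next triangle number. This makes the sum of the components accessible to unbounded
  search.\<close>

lemma Least_triangle:
  "(LEAST k. prod_encode (a, b) < triangle (Suc k)) = a + b"
proof (rule Least_equality)
  show "prod_encode (a, b) < triangle (Suc (a + b))"
    by (simp add: prod_encode_def)
  show "a + b \<le> k" if "prod_encode (a, b) < triangle (Suc k)" for k
  proof (rule ccontr)
    assume "\<not> a + b \<le> k"
    then have "triangle (Suc k) \<le> triangle (a + b)" by (intro triangle_mono) simp
    with that show False by (simp add: prod_encode_def)
  qed
qed

lemma total_recursive_on_code_sum:
  "total_recursive_on 1 (\<lambda>xs. code_fst (xs ! 0) + code_snd (xs ! 0))"
proof -
  \<comment> \<open>Truncated subtraction turns the search condition
    \<open>x < triangle (Suc n)\<close> into the zero test that \<open>Mu\<close> performs.\<close>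
  have "total_recursive_on 2 (\<lambda>xs. Suc (xs ! 1) - triangle (Suc (xs ! 0)))"
    by (intro recursive_intros) auto
  then have "recursive_on (Suc 1) (\<lambda>xs. Some (Suc (xs ! 1) - triangle (Suc (xs ! 0))))"
    by (simp add: numeral_2_eq_2)
  from recursive_on_Mu[OF this] show ?thesis
  proof (rule recursive_on_cong)
    fix xs :: "nat list"
    assume "length xs = 1"
    then obtain x where [simp]: "xs = [x]" by (auto simp: length_Suc_conv)
    obtain a b where ab: "prod_decode x = (a, b)" by fastforce
    then have x: "x = prod_encode (a, b)" by (metis prod_decode_inverse)
    have "(\<lambda>n. Some (Suc x - triangle (Suc n)) = Some 0) = (\<lambda>n. x < triangle (Suc n))"
      by auto
    moreover have "x < triangle (Suc (a + b))" by (simp add: x prod_encode_def)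
    ultimately show "(if \<exists>n. Some (Suc ((n # xs) ! 1) - triangle (Suc ((n # xs) ! 0))) = Some 0 \<and>
          (\<forall>m<n. Some (Suc ((m # xs) ! 1) - triangle (Suc ((m # xs) ! 0))) \<noteq> None)
        then Some (LEAST n. Some (Suc ((n # xs) ! 1) - triangle (Suc ((n # xs) ! 0))) = Some 0)
        else None) = Some (code_fst (xs ! 0) + code_snd (xs ! 0))"
      using Least_triangle[of a b] ab by (auto simp: x simp del: triangle_Suc)
  qed
qed

lemma total_recursive_on_code_fst [recursive_intros]:
  assumes "total_recursive_on k a"
  shows "total_recursive_on k (\<lambda>xs. code_fst (a xs))"
proof -
  have eq: "n - triangle (code_fst n + code_snd n) = code_fst n" for n
  proof -
    obtain a b where "prod_decode n = (a, b)" by fastforce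
    moreover from this have "n = triangle (a + b) + a"
      using prod_decode_inverse[of n] by (simp add: prod_encode_def)
    ultimately show ?thesis by simp
  qed
  moreover have "total_recursive_on k (\<lambda>xs. a xs - triangle (code_fst (a xs) + code_snd (a xs)))"
    using total_recursive_on_app1[of "\<lambda>n. code_fst n + code_snd n", OF total_recursive_on_code_sum assms]
    by (intro total_recursive_on_diff total_recursive_on_triangle assms)
  ultimately show ?thesis by (simp only: eq)
qed

lemma total_recursive_on_code_snd [recursive_intros]:
  assumes "total_recursive_on k a"
  shows "total_recursive_on k (\<lambda>xs. code_snd (a xs))"
proof -
  have "total_recursive_on k (\<lambda>xs. (code_fst (a xs) + code_snd (a xs)) - code_fst (a xs))"
    using total_recursive_on_app1[of "\<lambda>n. code_fst n + code_snd n", OF total_recursive_on_code_sum assms]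
    by (intro total_recursive_on_diff total_recursive_on_code_fst assms)
  then show ?thesis by simp
qed

section \<open>Partial conditionals and finite tables\<close>

lemma recursive_on_if:
  assumes c: "total_recursive_on k c" and F: "recursive_on k F" and G: "recursive_on k G"
  shows "recursive_on k (\<lambda>xs. if c xs = 0 then F xs else G xs)"
proof -
  \<comment> \<open>\<open>Comp\<close> is strict, so the branch not taken is suppressed by a recursion of length \<open>0\<close>.\<close>
  have guard: "recursive_on k (\<lambda>xs. if d xs = 0 then Some 0 else H xs)"
    if d: "total_recursive_on k d" and H: "recursive_on k H" for d H
  proof -
    have "recursive_on k (\<lambda>xs. Option.bind (Some (1 - (1 - d xs)))
       (\<lambda>y. rec_nat (Some 0) (\<lambda>m v. Option.bind v
         (\<lambda>z. H (drop 2 (m # z # tl (y # xs))))) (hd (y # xs))))"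
      by (rule recursive_on_bind[where G="\<lambda>xs. Some (1 - (1 - d xs))",
            OF _ recursive_on_rec_nat[where F="\<lambda>_. Some 0" and G="\<lambda>ys. H (drop 2 ys)"]])
        (use recursive_on_drop[OF H, of 2] d in \<open>auto intro!: recursive_intros\<close>)
    then show ?thesis
      by (rule recursive_on_cong) (auto simp: numeral_2_eq_2)
  qed
  \<comment> \<open>The two guarded branches are added: the branch not chosen contributes
    \<open>0\<close>, so value and definedness are those of the chosen one.\<close>
  have "recursive_on k (\<lambda>xs. Option.bind (if 1 - c xs = 0 then Some 0 else F xs)
      (\<lambda>y. Option.bind (if c (drop 1 (y # xs)) = 0 then Some 0 else G (drop 1 (y # xs)))
        (\<lambda>z. Some ((z # y # xs) ! 0 + (z # y # xs) ! 1))))"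
  proof (rule recursive_on_bind)
    show "recursive_on k (\<lambda>xs. if 1 - c xs = 0 then Some 0 else F xs)"
      by (intro guard F recursive_intros c)
    have "recursive_on (Suc k) (\<lambda>xs. if c (drop 1 xs) = 0 then Some 0 else G (drop 1 xs))"
      using recursive_on_drop[OF guard[OF c G], of 1] by simp
    then show "recursive_on (Suc k) (\<lambda>ys. Option.bind
        (if c (drop 1 ys) = 0 then Some 0 else G (drop 1 ys))
        (\<lambda>z. Some ((z # ys) ! 0 + (z # ys) ! 1)))"
      by (rule recursive_on_bind) (auto intro!: recursive_intros)
  qed
  then show ?thesis
    by (rule recursive_on_cong) (auto split: bind_splits)
qed

lemma total_recursive_on_table:
  assumes "finite D" and "total_recursive_on k a"
  shows "total_recursive_on k (\<lambda>xs. if a xs \<in> D then t (a xs) else 0)"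
  using assms(1)
proof induction
  case empty
  show ?case by (simp add: recursive_intros)
next
  case (insert d D)
  \<comment> \<open>The sum of both truncated differences vanishes exactly when
    \<open>a xs = d\<close>.\<close>
  have "total_recursive_on k (\<lambda>xs. if (a xs - d) + (d - a xs) = 0 then t d
      else if a xs \<in> D then t (a xs) else 0)"
    by (intro recursive_intros assms(2) insert.IH)
  then show ?case by (rule recursive_on_cong) auto
qed

lemma total_recursive_on_funpow:
  assumes "total_recursive_on 1 (\<lambda>xs. s (xs ! 0))"
    and "total_recursive_on k n" and "total_recursive_on k a"
  shows "total_recursive_on k (\<lambda>xs. (s ^^ n xs) (a xs))"
proof -
  have "rec_nat x (\<lambda>m y. s y) n = (s ^^ n) x" for x n
    by (induction n) auto
  then show ?thesis
    using total_recursive_on_rec_nat[of k a "\<lambda>ys. s (ys ! 1)" n] assms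
      total_recursive_on_app1[OF assms(1) recursive_on_nth[of 1 "Suc (Suc k)"]]
    by simp
qed

section \<open>Operations on codes of lists\<close>

definition code_cons :: "nat \<Rightarrow> nat \<Rightarrow> nat" where
  "code_cons x c = Suc (prod_encode (x, c))"

abbreviation code_hd :: "nat \<Rightarrow> nat" where
  "code_hd c \<equiv> code_fst (c - 1)"

abbreviation code_tl :: "nat \<Rightarrow> nat" where
  "code_tl c \<equiv> code_snd (c - 1)"

text \<open>The state pairs the part already reversed with the rest. It is fixed once the rest is
  empty, so surplus iterations are harmless.\<close>

definition code_rev_step :: "nat \<Rightarrow> nat" where
  "code_rev_step s = (if code_snd s = 0 then s
     else prod_encode (code_cons (code_hd (code_snd s)) (code_fst s), code_tl (code_snd s)))"

definition code_rev :: "nat \<Rightarrow> nat" where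
  "code_rev c = code_fst ((code_rev_step ^^ c) (prod_encode (0, c)))"

definition code_snoc :: "nat \<Rightarrow> nat \<Rightarrow> nat" where
  "code_snoc c x = code_rev (code_cons x (code_rev c))"

lemma code_cons_list_encode [simp]: "code_cons x (list_encode xs) = list_encode (x # xs)"
  by (simp add: code_cons_def)

text \<open>Lets \<open>code_rev\<close> use the code itself as the number of iterations.\<close>

lemma length_le_list_encode: "length xs \<le> list_encode xs"
proof (induction xs)
  case (Cons x xs)
  then show ?case using le_prod_encode_2[of "list_encode xs" x] by simp
qed simp

lemma code_rev_step_funpow:
  "length xs \<le> n \<Longrightarrow> (code_rev_step ^^ n) (prod_encode (list_encode ys, list_encode xs)) =
     prod_encode (list_encode (rev xs @ ys), 0)"
proof (induction n arbitrary: xs ys)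
  case (Suc n)
  show ?case
  proof (cases xs)
    case Nil
    then show ?thesis
      using Suc.IH[of "[]" ys] by (simp add: code_rev_step_def funpow_Suc_right del: funpow.simps)
  next
    case (Cons x zs)
    then have "code_rev_step (prod_encode (list_encode ys, list_encode xs)) =
        prod_encode (list_encode (x # ys), list_encode zs)"
      by (simp add: code_rev_step_def del: list_encode.simps(2))
        (simp add: code_cons_def)
    then show ?thesis
      using Suc.IH[of zs "x # ys"] Suc.prems Cons
      by (simp add: funpow_Suc_right del: funpow.simps list_encode.simps)
  qed
qed simp

lemma code_rev_list_encode [simp]: "code_rev (list_encode xs) = list_encode (rev xs)"
  using code_rev_step_funpow[OF length_le_list_encode, of xs "[]"] by (simp add: code_rev_def)

lemma code_snoc_list_encode [simp]: "code_snoc (list_encode xs) x = list_encode (xs @ [x])"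
  by (simp add: code_snoc_def del: list_encode.simps)

lemma total_recursive_on_code_cons [recursive_intros]:
  "total_recursive_on k a \<Longrightarrow> total_recursive_on k b \<Longrightarrow>
    total_recursive_on k (\<lambda>xs. code_cons (a xs) (b xs))"
  unfolding code_cons_def by (intro recursive_intros)

lemma total_recursive_on_code_rev [recursive_intros]:
  assumes "total_recursive_on k a"
  shows "total_recursive_on k (\<lambda>xs. code_rev (a xs))"
  unfolding code_rev_def
proof (intro recursive_intros total_recursive_on_funpow assms)
  show "total_recursive_on 1 (\<lambda>xs. code_rev_step (xs ! 0))"
    unfolding code_rev_step_def by (intro recursive_intros) auto
qed

lemma total_recursive_on_code_snoc [recursive_intros]:
  "total_recursive_on k a \<Longrightarrow> total_recursive_on k b \<Longrightarrow>
    total_recursive_on k (\<lambda>xs. code_snoc (a xs) (b xs))"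
  unfolding code_snoc_def by (intro recursive_intros)


section \<open>Unbounded loops\<close>

text \<open>A step returns a tagged value: tag \<open>0\<close> means go on from the second
  component, any other tag means stop and output it.\<close>

partial_function (option) loop :: "(nat \<Rightarrow> nat option) \<Rightarrow> nat \<Rightarrow> nat option" where
  "loop S s = Option.bind (S s)
     (\<lambda>c. if code_fst c = 0 then loop S (code_snd c) else Some (code_snd c))"

text \<open>The bounded version of \<open>loop\<close>, within reach of primitive recursion; a
  stopped result keeps its tag through the remaining rounds.\<close>

definition iterate :: "(nat \<Rightarrow> nat option) \<Rightarrow> nat \<Rightarrow> nat \<Rightarrow> nat option" where
  "iterate S t s = rec_nat (Some (prod_encode (0, s)))
     (\<lambda>_ v. Option.bind v (\<lambda>c. if code_fst c = 0 then S (code_snd c) else Some c)) t"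

lemma iterate_0: "iterate S 0 s = Some (prod_encode (0, s))"
  by (simp add: iterate_def)

text \<open>The recursion in \<open>iterate\<close> adds a round at the end, whereas
  \<open>loop\<close> unfolds at the front; this bridges the two.\<close>

lemma iterate_Suc:
  "iterate S (Suc t) s =
     Option.bind (S s) (\<lambda>c. if code_fst c = 0 then iterate S t (code_snd c) else Some c)"
proof (induction t)
  case 0
  show ?case
    by (cases "S s") (auto simp: iterate_def, metis prod.collapse prod_decode_inverse)
next
  case (Suc t)
  have "iterate S (Suc (Suc t)) s = Option.bind (iterate S (Suc t) s)
      (\<lambda>c. if code_fst c = 0 then S (code_snd c) else Some c)"
    by (simp add: iterate_def)
  also have "\<dots> = Option.bind (S s)
      (\<lambda>c. if code_fst c = 0 then iterate S (Suc t) (code_snd c) else Some c)"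
    unfolding Suc.IH by (cases "S s") (auto simp: iterate_def)
  finally show ?case .
qed

text \<open>\<open>Mu\<close> demands defined values below the least zero; this supplies
  them.\<close>

lemma iterate_defined_downward:
  "iterate S t s \<noteq> None \<Longrightarrow> m \<le> t \<Longrightarrow> iterate S m s \<noteq> None"
proof (induction t)
  case (Suc t)
  then show ?case by (cases "m = Suc t") (auto simp: iterate_def split: bind_splits)
qed simp

lemma loop_if_iterate:
  "iterate S t s = Some c \<Longrightarrow> code_fst c \<noteq> 0 \<Longrightarrow> loop S s = Some (code_snd c)"
proof (induction t arbitrary: s)
  case (Suc t)
  then show ?case
    by (subst loop.simps) (auto simp: iterate_Suc split: bind_splits if_splits)
qed (auto simp: iterate_0)

lemma iterate_if_loop:
  assumes "loop S s = Some v"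
  shows "\<exists>t c. iterate S t s = Some c \<and> code_fst c \<noteq> 0"
proof (rule loop.raw_induct[where P="\<lambda>S s _. \<exists>t c. iterate S t s = Some c \<and> code_fst c \<noteq> 0",
      OF _ assms], goal_cases)
  case (1 loop S s v)
  then obtain c where c: "S s = Some c"
    by (auto split: bind_splits)
  show ?case
  proof (cases "code_fst c = 0")
    case True
    with 1 c obtain t d where "iterate S t (code_snd c) = Some d" "code_fst d \<noteq> 0"
      by fastforce
    then show ?thesis
      using c True by (intro exI[of _ "Suc t"] exI[of _ d]) (simp add: iterate_Suc)
  next
    case False
    then show ?thesis
      using c by (intro exI[of _ "Suc 0"] exI[of _ c]) (simp add: iterate_Suc)
  qed
qed

text \<open>\<open>Mu\<close> finds the first number of rounds after which the tag is nonzero;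
  running \<open>iterate\<close> again for that many rounds yields the output.\<close>

lemma recursive_on_loop:
  assumes "recursive_on 1 (\<lambda>xs. S (xs ! 0))"
  shows "recursive_on 1 (\<lambda>xs. loop S (xs ! 0))"
proof -
  have S: "recursive_on k (\<lambda>xs. S (a xs))" if "total_recursive_on k a" for k a
    using recursive_on_app[OF assms that] by simp
  have "recursive_on (Suc 1) (\<lambda>xs. rec_nat (Some (prod_encode (0, tl xs ! 0)))
      (\<lambda>m v. Option.bind v (\<lambda>y. if code_fst ((m # y # tl xs) ! 1) = 0
         then S (code_snd ((m # y # tl xs) ! 1)) else Some ((m # y # tl xs) ! 1))) (hd xs))"
    by (rule recursive_on_rec_nat[where F="\<lambda>xs. Some (prod_encode (0, xs ! 0))"
          and G="\<lambda>ys. if code_fst (ys ! 1) = 0 then S (code_snd (ys ! 1)) else Some (ys ! 1)"])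
      (auto intro!: recursive_on_if S recursive_intros)
  then have iter: "recursive_on (Suc 1) (\<lambda>xs. iterate S (xs ! 0) (xs ! 1))"
    by (rule recursive_on_cong) (auto simp: iterate_def length_Suc_conv cong: if_cong)
  have "recursive_on (Suc 1) (\<lambda>xs. Option.bind (iterate S (xs ! 0) (xs ! 1))
      (\<lambda>c. Some (1 - code_fst ((c # xs) ! 0))))"
    by (rule recursive_on_bind[OF iter]) (auto intro!: recursive_intros)
  note Mu = recursive_on_Mu[OF this]
  have "recursive_on (Suc 1) (\<lambda>xs. Option.bind (iterate S (xs ! 0) (xs ! 1))
      (\<lambda>c. Some (code_snd ((c # xs) ! 0))))"
    by (rule recursive_on_bind[OF iter]) (auto intro!: recursive_intros)
  from recursive_on_bind[OF Mu this] show ?thesis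
  proof (rule recursive_on_cong, goal_cases)
    case (1 xs)
    then obtain x where [simp]: "xs = [x]" by (auto simp: length_Suc_conv)
    let ?halts = "\<lambda>t. Option.bind (iterate S t x) (\<lambda>c. Some (1 - code_fst c)) = Some 0"
    have halts: "?halts t \<longleftrightarrow> (\<exists>c. iterate S t x = Some c \<and> code_fst c \<noteq> 0)" for t
      by (auto split: bind_splits)
    show ?case
    proof (cases "\<exists>t. ?halts t")
      case True
      then obtain t where t: "?halts t" by blast
      have "\<forall>m<t. Option.bind (iterate S m x) (\<lambda>c. Some (1 - code_fst c)) \<noteq> None"
      proof (intro allI impI)
        fix m assume "m < t"
        with t iterate_defined_downward[of S t x m]
        show "Option.bind (iterate S m x) (\<lambda>c. Some (1 - code_fst c)) \<noteq> None"
          by (auto split: bind_splits)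
      qed
      moreover obtain c where "iterate S (LEAST t. ?halts t) x = Some c" "code_fst c \<noteq> 0"
        using LeastI[of ?halts t, OF t] halts by blast
      ultimately show ?thesis
        using t loop_if_iterate[of S "LEAST t. ?halts t" x c] by auto
    next
      case False
      then have "loop S x = None"
        using iterate_if_loop[of S x] halts by (cases "loop S x") auto
      with False show ?thesis by auto
    qed
  qed
qed

section \<open>Sequential computations\<close>

definition decode_action :: "nat \<Rightarrow> bool \<times> nat" where
  "decode_action y = (code_fst y \<noteq> 0, code_snd y)"

definition code_program :: "(nat list \<Rightarrow> (bool \<times> nat) option) \<Rightarrow> nat \<Rightarrow> nat option" where
  "code_program \<Phi> c = map_option (\<lambda>(b, q). prod_encode (of_bool b, q)) (\<Phi> (list_decode c))"

lemma recursive_on_code_program: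
  assumes "partial_computable \<Phi>" and "total_recursive_on k a"
  shows "recursive_on k (\<lambda>xs. code_program \<Phi> (a xs))"
proof -
  obtain r where r: "\<And>xs. eval_recf r [list_encode xs] =
      map_option (\<lambda>(b, q). prod_encode (of_bool b, q)) (\<Phi> xs)"
    using assms(1) unfolding partial_computable_def by blast
  have "eval_recf r [x] = code_program \<Phi> x" for x
    using r[of "list_decode x"] by (simp add: code_program_def)
  then have "recursive_on 1 (\<lambda>xs. code_program \<Phi> (xs ! 0))"
    unfolding recursive_on_def by (auto simp: length_Suc_conv intro!: exI[of _ r])
  from recursive_on_app[OF this assms(2)] show ?thesis by simp
qed

lemma partial_computable_decode_action:
  assumes "recursive_on 1 (\<lambda>xs. G (xs ! 0))"
  shows "partial_computable (\<lambda>xs. map_option decode_action (G (list_encode xs)))"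
proof -
  \<comment> \<open>The tag is normalised to \<open>0\<close> or \<open>1\<close>, the only values
    that \<open>partial_computable\<close> allows.\<close>
  have "recursive_on 1 (\<lambda>xs. Option.bind (G (xs ! 0))
      (\<lambda>y. Some (prod_encode (1 - (1 - code_fst ((y # xs) ! 0)), code_snd ((y # xs) ! 0)))))"
    by (rule recursive_on_bind[OF assms]) (auto intro!: recursive_intros)
  then obtain r where "\<And>xs. length xs = 1 \<Longrightarrow> eval_recf r xs = Option.bind (G (xs ! 0))
      (\<lambda>y. Some (prod_encode (1 - (1 - code_fst ((y # xs) ! 0)), code_snd ((y # xs) ! 0))))"
    unfolding recursive_on_def by blast
  from this[of "[x]" for x] have r: "\<And>x. eval_recf r [x] = Option.bind (G x)
      (\<lambda>y. Some (prod_encode (1 - (1 - code_fst y), code_snd y)))"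
    by simp
  show ?thesis
    unfolding partial_computable_def
    by (intro exI[of _ r] allI) (auto simp: r decode_action_def split: bind_splits)
qed

lemma run_halt: "\<Phi> xs = Some (True, v) \<Longrightarrow> run \<Phi> H xs = Some v"
  by (simp add: run.simps)

lemma run_query: "\<Phi> xs = Some (False, q) \<Longrightarrow> H q = Some a \<Longrightarrow> run \<Phi> H xs = run \<Phi> H (xs @ [a])"
  by (subst run.simps) simp

lemma run_stuck: "\<Phi> xs = Some (False, q) \<Longrightarrow> H q = None \<Longrightarrow> run \<Phi> H xs = None"
  by (subst run.simps) simp

lemma run_induct [consumes 1, case_names halt query]:
  assumes "run \<Phi> H xs = Some v"
    and halt: "\<And>xs. \<Phi> xs = Some (True, v) \<Longrightarrow> P xs"
    and query: "\<And>xs q a. \<Phi> xs = Some (False, q) \<Longrightarrow> H q = Some a \<Longrightarrow> P (xs @ [a]) \<Longrightarrow> P xs"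
  shows "P xs"
proof -
  \<comment> \<open>Both closure conditions are moved into the induction predicate because the raw
    rule varies \<Phi>, the oracle and \<open>v\<close>.\<close>
  have "(\<forall>xs. \<Phi> xs = Some (True, v) \<longrightarrow> P xs) \<longrightarrow>
      (\<forall>xs q a. \<Phi> xs = Some (False, q) \<longrightarrow> H q = Some a \<longrightarrow> P (xs @ [a]) \<longrightarrow> P xs) \<longrightarrow> P xs"
  proof (rule run.raw_induct[where P="\<lambda>\<Phi> H xs v. (\<forall>xs. \<Phi> xs = Some (True, v) \<longrightarrow> P xs) \<longrightarrow>
      (\<forall>xs q a. \<Phi> xs = Some (False, q) \<longrightarrow> H q = Some a \<longrightarrow> P (xs @ [a]) \<longrightarrow> P xs) \<longrightarrow> P xs",
      OF _ assms(1)], goal_cases)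
    case (1 run \<Phi> H xs v)
    show ?case
    proof (intro impI)
      assume h: "\<forall>xs. \<Phi> xs = Some (True, v) \<longrightarrow> P xs"
        and q: "\<forall>xs q a. \<Phi> xs = Some (False, q) \<longrightarrow> H q = Some a \<longrightarrow> P (xs @ [a]) \<longrightarrow> P xs"
      from 1(2) consider "\<Phi> xs = Some (True, v)"
        | q a where "\<Phi> xs = Some (False, q)" "H q = Some a" "run \<Phi> H (xs @ [a]) = Some v"
        by (auto split: option.splits if_splits)
      then show "P xs"
      proof cases
        case 2
        with 1(1) h q show ?thesis by blast
      qed (use h in blast)
    qed
  qed
  with halt query show ?thesis by blast
qed

text \<open>Translated queries receive the same answers, so the two histories differ only in their
  input. This suits reductions that merely retag inputs or queries.\<close>

lemma run_simulate:
  assumes "run \<Phi> H (x # as) = Some v"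
    and halt: "\<And>as. \<Phi> (x # as) = Some (True, v) \<Longrightarrow> \<Psi> (y # as) = Some (True, v)"
    and query: "\<And>as q a. \<Phi> (x # as) = Some (False, q) \<Longrightarrow> H q = Some a \<Longrightarrow>
      \<exists>q'. \<Psi> (y # as) = Some (False, q') \<and> H' q' = Some a"
  shows "run \<Psi> H' (y # as) = Some v"
proof -
  have "\<forall>as. xs = x # as \<longrightarrow> run \<Psi> H' (y # as) = Some v"
    if "run \<Phi> H xs = Some v" for xs
    using that
  proof (induction rule: run_induct)
    case (halt xs)
    then show ?case using assms(2) by (auto intro: run_halt)
  next
    case (query xs q a)
    show ?case
    proof (intro allI impI)
      fix as assume xs: "xs = x # as"
      with query assms(3) obtain q' where "\<Psi> (y # as) = Some (False, q')" "H' q' = Some a"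
        by blast
      then show "run \<Psi> H' (y # as) = Some v"
        using query.IH xs run_query[of \<Psi> "y # as" q' H' a] by simp
    qed
  qed
  with assms(1) show ?thesis by blast
qed

section \<open>Joins and their reductions\<close>

definition join :: "(nat \<Rightarrow> nat option) \<Rightarrow> (nat \<Rightarrow> nat option) \<Rightarrow> nat \<Rightarrow> nat option" where
  "join g f x = (if code_fst x = 0 then g (code_snd x) else f (code_snd x))"

lemma subT_le_join1: "g \<le>\<^sub>s\<^sub>u\<^sub>b\<^sub>T join g f"
proof -
  \<comment> \<open>\<open>code_tl c = 0\<close> says that no answer has arrived yet, as the empty
    list has code \<open>0\<close>.\<close>
  define G where "G c = Some (if code_tl c = 0
      then prod_encode (0, prod_encode (0, code_hd c))
      else prod_encode (1, code_hd (code_tl c)))" for c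
  let ?\<Psi> = "\<lambda>xs. map_option decode_action (G (list_encode xs))"
  have "partial_computable ?\<Psi>"
    unfolding G_def by (intro partial_computable_decode_action recursive_intros) auto
  moreover have "seq_computation ?\<Psi> (join g f) n = Some v" if "g n = Some v" for n v
  proof -
    have "?\<Psi> [n] = Some (False, prod_encode (0, n))" "?\<Psi> [n, v] = Some (True, v)"
      by (simp_all add: G_def decode_action_def)
    then show ?thesis
      using that run_query[of ?\<Psi> "[n]" "prod_encode (0, n)" "join g f" v]
      by (simp add: seq_computation_def run_halt join_def)
  qed
  ultimately show ?thesis
    unfolding subT_le_def map_le_def dom_def by (intro exI[of _ ?\<Psi>]) auto
qed

text \<open>A reduction only has to be right on the domain of the reduced function, so
  \<open>f\<close> answers for its restriction to an arbitrary set \<open>A\<close>, computable or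
  not.\<close>

lemma join_restrict_subT_le:
  assumes "g \<le>\<^sub>s\<^sub>u\<^sub>b\<^sub>T f"
  shows "join g (f |` A) \<le>\<^sub>s\<^sub>u\<^sub>b\<^sub>T f"
proof -
  obtain \<Phi> where \<Phi>: "partial_computable \<Phi>" "g \<subseteq>\<^sub>m seq_computation \<Phi> f"
    using assms unfolding subT_le_def by blast
  define G where "G c = (if code_fst (code_hd c) = 0
      then code_program \<Phi> (code_cons (code_snd (code_hd c)) (code_tl c))
      else Some (if code_tl c = 0 then prod_encode (0, code_snd (code_hd c))
        else prod_encode (1, code_hd (code_tl c))))" for c
  let ?\<Psi> = "\<lambda>xs. map_option decode_action (G (list_encode xs))"
  have "partial_computable ?\<Psi>"
    unfolding G_def
    by (intro partial_computable_decode_action recursive_on_if recursive_on_code_program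
        recursive_intros \<Phi>) auto
  moreover have "seq_computation ?\<Psi> f x = Some v" if v: "join g (f |` A) x = Some v" for x v
  proof (cases "code_fst x = 0")
    case True
    let ?n = "code_snd x"
    have "run \<Phi> f [?n] = Some v"
      using v True \<Phi>(2) by (auto simp: join_def map_le_def dom_def seq_computation_def)
    then have "run ?\<Psi> f [x] = Some v"
    proof (rule run_simulate)
      have \<Psi>: "?\<Psi> (x # as) = \<Phi> (?n # as)" for as
        using True by (auto simp: G_def code_program_def decode_action_def code_cons_def
            option.map_comp comp_def case_prod_beta intro!: option.map_ident_strong)
      show "?\<Psi> (x # as) = Some (True, v)" if "\<Phi> (?n # as) = Some (True, v)" for as
        using that \<Psi> by simp
      show "\<exists>q'. ?\<Psi> (x # as) = Some (False, q') \<and> f q' = Some a"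
        if "\<Phi> (?n # as) = Some (False, q)" "f q = Some a" for as q a
        using that \<Psi> by simp
    qed
    then show ?thesis by (simp add: seq_computation_def)
  next
    case False
    then have "?\<Psi> [x] = Some (False, code_snd x)" "?\<Psi> [x, v] = Some (True, v)"
      by (simp_all add: G_def decode_action_def)
    moreover have "f (code_snd x) = Some v"
      using v False by (auto simp: join_def restrict_map_def split: if_splits)
    ultimately show ?thesis
      using run_query[of ?\<Psi> "[x]" "code_snd x" f v]
      by (simp add: seq_computation_def run_halt)
  qed
  ultimately show ?thesis
    unfolding subT_le_def map_le_def dom_def by (intro exI[of _ ?\<Psi>]) auto
qed

text \<open>Queries to \<open>g\<close> are redirected to the left half by the tag
  \<open>0\<close>.\<close>

lemma subT_le_join1_trans:
  assumes "h \<le>\<^sub>s\<^sub>u\<^sub>b\<^sub>T g"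
  shows "h \<le>\<^sub>s\<^sub>u\<^sub>b\<^sub>T join g f"
proof -
  obtain \<Phi> where \<Phi>: "partial_computable \<Phi>" "h \<subseteq>\<^sub>m seq_computation \<Phi> g"
    using assms unfolding subT_le_def by blast
  define G where "G c = Option.bind (code_program \<Phi> c) (\<lambda>y. Some (if code_fst y = 0
      then prod_encode (0, prod_encode (0, code_snd y)) else y))" for c
  let ?\<Psi> = "\<lambda>xs. map_option decode_action (G (list_encode xs))"
  have "recursive_on 1 (\<lambda>xs. Option.bind (code_program \<Phi> (xs ! 0))
      (\<lambda>y. Some (if code_fst ((y # xs) ! 0) = 0
         then prod_encode (0, prod_encode (0, code_snd ((y # xs) ! 0))) else (y # xs) ! 0)))"
    by (rule recursive_on_bind[OF recursive_on_code_program[OF \<Phi>(1)]])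
      (auto intro!: recursive_intros)
  then have "partial_computable ?\<Psi>"
    unfolding G_def by (intro partial_computable_decode_action) (simp cong: if_cong)
  moreover have "seq_computation ?\<Psi> (join g f) x = Some v" if v: "h x = Some v" for x v
  proof -
    have "run \<Phi> g [x] = Some v"
      using v \<Phi>(2) by (auto simp: map_le_def dom_def seq_computation_def)
    then have "run ?\<Psi> (join g f) [x] = Some v"
      by (rule run_simulate) (simp_all add: G_def code_program_def decode_action_def join_def
        del: list_encode.simps)
    then show ?thesis by (simp add: seq_computation_def)
  qed
  ultimately show ?thesis
    unfolding subT_le_def map_le_def dom_def by (intro exI[of _ ?\<Psi>]) auto
qed

lemma map_le_subT_le:
  assumes "f \<le>\<^sub>s\<^sub>u\<^sub>b\<^sub>T h" and "g \<subseteq>\<^sub>m f"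
  shows "g \<le>\<^sub>s\<^sub>u\<^sub>b\<^sub>T h"
  using assms map_le_trans unfolding subT_le_def by blast

lemma subT_le_join2D:
  assumes "join g f \<le>\<^sub>s\<^sub>u\<^sub>b\<^sub>T h"
  shows "f \<le>\<^sub>s\<^sub>u\<^sub>b\<^sub>T h"
proof -
  obtain \<Phi> where \<Phi>: "partial_computable \<Phi>" "join g f \<subseteq>\<^sub>m seq_computation \<Phi> h"
    using assms unfolding subT_le_def by blast
  define G where
    "G c = code_program \<Phi> (code_cons (prod_encode (1, code_hd c)) (code_tl c))" for c
  let ?\<Psi> = "\<lambda>xs. map_option decode_action (G (list_encode xs))"
  have "partial_computable ?\<Psi>"
    unfolding G_def
    by (intro partial_computable_decode_action recursive_on_code_program recursive_intros \<Phi>) auto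
  moreover have "seq_computation ?\<Psi> h n = Some v" if v: "f n = Some v" for n v
  proof -
    have "join g f (prod_encode (1, n)) = Some v" using v by (simp add: join_def)
    then have "run \<Phi> h [prod_encode (1, n)] = Some v"
      using \<Phi>(2) by (force simp: map_le_def dom_def seq_computation_def)
    then have "run ?\<Psi> h [n] = Some v"
      by (rule run_simulate)
        (simp_all add: G_def code_program_def decode_action_def code_cons_def)
    then show ?thesis by (simp add: seq_computation_def)
  qed
  ultimately show ?thesis
    unfolding subT_le_def map_le_def dom_def by (intro exI[of _ ?\<Psi>]) auto
qed

section \<open>Simulation with a finite part of the oracle hard-coded\<close>

definition sim_step ::
  "(nat list \<Rightarrow> (bool \<times> nat) option) \<Rightarrow> (nat \<Rightarrow> nat) \<Rightarrow> nat \<Rightarrow> nat option" where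
  "sim_step \<Phi> t s = Option.bind (code_program \<Phi> (code_fst s)) (\<lambda>y. Some (
     if code_fst y = 0 then
       if code_fst (code_snd y) = 0 then
         if code_snd s = 0 then prod_encode (1, prod_encode (0, code_snd (code_snd y)))
         else prod_encode (0, prod_encode
           (code_snoc (code_fst s) (code_hd (code_snd s)), code_tl (code_snd s)))
       else if t (code_snd (code_snd y)) = 0 then prod_encode (1, 0)
       else prod_encode (0, prod_encode
         (code_snoc (code_fst s) (t (code_snd (code_snd y)) - 1), code_snd s))
     else prod_encode (1, y)))"

text \<open>
  \<open>sim \<Phi> t ys as\<close> continues the computation of \<open>\<Phi>\<close> from the history \<open>ys\<close>: queries to the left
  half of a join consume the answers \<open>as\<close>, queries \<open>m\<close> to the right half are answered from the
  table \<open>t\<close>, where \<open>t m = 0\<close> means no entry and \<open>t m = Suc v\<close> means the answer \<open>v\<close>.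
\<close>

definition sim ::
  "(nat list \<Rightarrow> (bool \<times> nat) option) \<Rightarrow> (nat \<Rightarrow> nat) \<Rightarrow> nat list \<Rightarrow> nat list \<Rightarrow> nat option" where
  "sim \<Phi> t ys as = loop (sim_step \<Phi> t) (prod_encode (list_encode ys, list_encode as))"

lemma sim_halt: "\<Phi> ys = Some (True, v) \<Longrightarrow> sim \<Phi> t ys as = Some (prod_encode (1, v))"
  unfolding sim_def by (subst loop.simps) (simp add: sim_step_def code_program_def)

lemma sim_query_left_Nil:
  "\<Phi> ys = Some (False, q) \<Longrightarrow> code_fst q = 0 \<Longrightarrow>
    sim \<Phi> t ys [] = Some (prod_encode (0, code_snd q))"
  unfolding sim_def by (subst loop.simps) (simp add: sim_step_def code_program_def)

lemma sim_query_left_Cons: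
  "\<Phi> ys = Some (False, q) \<Longrightarrow> code_fst q = 0 \<Longrightarrow>
    sim \<Phi> t ys (a # as) = sim \<Phi> t (ys @ [a]) as"
  unfolding sim_def by (subst loop.simps) (simp add: sim_step_def code_program_def)

lemma sim_query_right:
  "\<Phi> ys = Some (False, q) \<Longrightarrow> code_fst q \<noteq> 0 \<Longrightarrow> t (code_snd q) = Suc a \<Longrightarrow>
    sim \<Phi> t ys as = sim \<Phi> t (ys @ [a]) as"
  unfolding sim_def by (subst loop.simps) (simp add: sim_step_def code_program_def)

lemma recursive_on_sim:
  assumes \<Phi>: "partial_computable \<Phi>"
    and t: "\<And>k a. total_recursive_on k a \<Longrightarrow> total_recursive_on k (\<lambda>xs. t (a xs))"
    and s: "total_recursive_on k s"
  shows "recursive_on k (\<lambda>xs. loop (sim_step \<Phi> t) (s xs))"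
proof -
  have "recursive_on 1 (\<lambda>xs. Option.bind (code_program \<Phi> (code_fst (xs ! 0)))
      (\<lambda>y. (\<lambda>ys. Some (
       if code_fst (ys ! 0) = 0 then
         if code_fst (code_snd (ys ! 0)) = 0 then
           if code_snd (ys ! 1) = 0
           then prod_encode (1, prod_encode (0, code_snd (code_snd (ys ! 0))))
           else prod_encode (0, prod_encode
             (code_snoc (code_fst (ys ! 1)) (code_hd (code_snd (ys ! 1))), code_tl (code_snd (ys ! 1))))
         else if t (code_snd (code_snd (ys ! 0))) = 0 then prod_encode (1, 0)
         else prod_encode (0, prod_encode
           (code_snoc (code_fst (ys ! 1)) (t (code_snd (code_snd (ys ! 0))) - 1), code_snd (ys ! 1)))
       else prod_encode (1, ys ! 0))) (y # xs)))"
    by (rule recursive_on_bind; intro recursive_on_code_program \<Phi> recursive_intros t) auto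
  then have "recursive_on 1 (\<lambda>xs. sim_step \<Phi> t (xs ! 0))"
    by (rule recursive_on_cong) (simp add: sim_step_def cong: if_cong)
  from recursive_on_app[OF recursive_on_loop[OF this] s] show ?thesis by simp
qed

text \<open>Table answers enter only the simulated history, so \<Psi> asks and records answers of
  \<open>g\<close> alone. At each call it replays the simulation from the start.\<close>

lemma run_sim:
  assumes t: "\<And>m a. m \<in> I \<Longrightarrow> f m = Some a \<Longrightarrow> t m = Suc a"
    and \<Psi>: "\<And>as. \<Psi> (n # as) = map_option decode_action (sim \<Phi> t [x] as)"
    and "run \<Phi> (join g (f |` I)) [x] = Some v"
  shows "run \<Psi> g [n] = Some v"
proof -
  \<comment> \<open>Invariant: replaying the \<open>g\<close>-answers \<open>as\<close> takes the
    simulation from \<open>[x]\<close> to the current history \<open>ys\<close>, whatever answers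
    \<open>bs\<close> follow.\<close>
  have "\<forall>as. (\<forall>bs. sim \<Phi> t [x] (as @ bs) = sim \<Phi> t ys bs) \<longrightarrow> run \<Psi> g (n # as) = Some v"
    if "run \<Phi> (join g (f |` I)) ys = Some v" for ys
    using that
  proof (induction rule: run_induct)
    case (halt ys)
    show ?case
    proof (intro allI impI)
      fix as assume "\<forall>bs. sim \<Phi> t [x] (as @ bs) = sim \<Phi> t ys bs"
      then have "sim \<Phi> t [x] as = sim \<Phi> t ys []" by (metis append_Nil2)
      then show "run \<Psi> g (n # as) = Some v"
        using halt by (intro run_halt) (simp add: \<Psi> sim_halt decode_action_def)
    qed
  next
    case (query ys q a)
    show ?case
    proof (intro allI impI)
      fix as assume as: "\<forall>bs. sim \<Phi> t [x] (as @ bs) = sim \<Phi> t ys bs"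
      show "run \<Psi> g (n # as) = Some v"
      proof (cases "code_fst q = 0")
        case True
        have "sim \<Phi> t [x] as = sim \<Phi> t ys []" using as by (metis append_Nil2)
        then have "\<Psi> (n # as) = Some (False, code_snd q)"
          using query.hyps(1) True by (simp add: \<Psi> sim_query_left_Nil decode_action_def)
        moreover have "g (code_snd q) = Some a"
          using query.hyps(2) True by (simp add: join_def)
        moreover have "\<forall>bs. sim \<Phi> t [x] ((as @ [a]) @ bs) = sim \<Phi> t (ys @ [a]) bs"
          using as query.hyps(1) True by (simp add: sim_query_left_Cons)
        ultimately show ?thesis
          using query.IH run_query[of \<Psi> "n # as" "code_snd q" g a] by (metis append_Cons)
      next
        case False
        then have "t (code_snd q) = Suc a"
          using query.hyps(2) t by (auto simp: join_def restrict_map_def split: if_splits)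
        then have "\<forall>bs. sim \<Phi> t [x] (as @ bs) = sim \<Phi> t (ys @ [a]) bs"
          using as query.hyps(1) False by (metis sim_query_right)
        then show ?thesis using query.IH by blast
      qed
    qed
  qed
  with assms(3) show ?thesis by (metis append_Nil)
qed

section \<open>Finite conditions\<close>

text \<open>If \<Phi> were right on all inputs outside \<open>D\<close>, then \<open>f\<close> would
  reduce to \<open>g\<close>: values on \<open>D\<close> and answers on \<open>I\<close> come from
  finite tables, and only queries to the left half go to \<open>g\<close>.\<close>

lemma fresh_disagreement:
  assumes nle: "\<not> f \<le>\<^sub>s\<^sub>u\<^sub>b\<^sub>T g" and \<Phi>: "partial_computable \<Phi>" and "finite D" and "finite I"
  obtains n v where "n \<notin> D" and "f n = Some v"
    and "run \<Phi> (join g (f |` I)) [n] \<noteq> Some v"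
proof (rule ccontr)
  assume "\<not> thesis"
  with that have agree: "run \<Phi> (join g (f |` I)) [n] = Some v"
    if "n \<notin> D" "f n = Some v" for n v
    using that by blast
  define t where "t E m = (if m \<in> E then case f m of None \<Rightarrow> 0 | Some v \<Rightarrow> Suc v else 0)" for E m
  have t: "total_recursive_on k (\<lambda>xs. t E (a xs))"
    if "finite E" "total_recursive_on k a" for E k a
    using total_recursive_on_table[OF that, of "\<lambda>m. case f m of None \<Rightarrow> 0 | Some v \<Rightarrow> Suc v"]
    by (simp add: t_def)
  \<comment> \<open>A zero from \<open>t D\<close> starts the simulation at the one-element history,
    coded by \<open>code_cons\<close> with the empty list \<open>0\<close>. Inputs in
    \<open>D\<close> outside the domain of \<open>f\<close> land there too, where nothing is
    demanded.\<close>
  define G where "G c = (if t D (code_hd c) = 0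
      then loop (sim_step \<Phi> (t I))
        (prod_encode (code_cons (code_hd c) 0, code_tl c))
      else Some (prod_encode (1, t D (code_hd c) - 1)))" for c
  let ?\<Psi> = "\<lambda>xs. map_option decode_action (G (list_encode xs))"
  have "partial_computable ?\<Psi>"
    unfolding G_def
    by (intro partial_computable_decode_action recursive_on_if recursive_on_sim
        recursive_intros \<Phi> t assms(3,4)) auto
  moreover have "seq_computation ?\<Psi> g n = Some v" if v: "f n = Some v" for n v
  proof (cases "n \<in> D")
    case True
    then show ?thesis
      using v by (simp add: seq_computation_def run_halt G_def t_def decode_action_def)
  next
    case False
    have "run ?\<Psi> g [n] = Some v"
    proof (rule run_sim)
      show "t I m = Suc a" if "m \<in> I" "f m = Some a" for m a
        using that by (simp add: t_def)
      show "?\<Psi> (n # as) = map_option decode_action (sim \<Phi> (t I) [n] as)" for as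
        using False by (simp add: G_def t_def sim_def code_cons_def)
      show "run \<Phi> (join g (f |` I)) [n] = Some v"
        using agree[OF False v] .
    qed
    then show ?thesis by (simp add: seq_computation_def)
  qed
  ultimately have "f \<le>\<^sub>s\<^sub>u\<^sub>b\<^sub>T g"
    unfolding subT_le_def map_le_def dom_def by (intro exI[of _ ?\<Psi>]) auto
  with nle show False by blast
qed

text \<open>
  A computation that fails with oracle \<open>f |` I\<close> but succeeds with a larger one gets stuck at a
  single query \<open>m\<close>; keeping \<open>m\<close> out of the oracle keeps it stuck.
\<close>

lemma run_blocking_query:
  assumes "I \<subseteq> B" and "run \<Phi> (join g (f |` B)) xs = Some v"
    and "run \<Phi> (join g (f |` I)) xs \<noteq> Some v"
  obtains m where "m \<notin> I"
    and "\<And>C. I \<subseteq> C \<Longrightarrow> m \<notin> C \<Longrightarrow> run \<Phi> (join g (f |` C)) xs = None"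
proof -
  \<comment> \<open>Failure for \<open>I\<close> is recast as failure of the first alternative, so
    that induction can follow the successful run with \<open>B\<close>.\<close>
  have "run \<Phi> (join g (f |` I)) xs = Some v \<or>
      (\<exists>m. m \<notin> I \<and> (\<forall>C. I \<subseteq> C \<longrightarrow> m \<notin> C \<longrightarrow> run \<Phi> (join g (f |` C)) xs = None))"
    using assms(2)
  proof (induction rule: run_induct)
    case (halt xs)
    then show ?case by (simp add: run_halt)
  next
    case (query xs q a)
    show ?case
    \<comment> \<open>Either every \<open>C\<close> containing \<open>I\<close> gives the same
      answer and the run moves on, or the query lies in the right half outside \<open>I\<close> and
      blocks every \<open>C\<close> that omits it.\<close>
    proof (cases "code_fst q = 0 \<or> code_snd q \<in> I")
      case True
      then have "join g (f |` C) q = Some a" if "I \<subseteq> C" for C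
        using query.hyps(2) that assms(1)
        by (auto simp: join_def restrict_map_def split: if_splits)
      then have "run \<Phi> (join g (f |` C)) xs = run \<Phi> (join g (f |` C)) (xs @ [a])"
        if "I \<subseteq> C" for C
        using run_query[of \<Phi> xs q _ a, OF query.hyps(1)] that by blast
      with query.IH show ?thesis by auto
    next
      case False
      then have "run \<Phi> (join g (f |` C)) xs = None" if "code_snd q \<notin> C" for C
        using that query.hyps(1) by (intro run_stuck[of \<Phi> xs q]) (auto simp: join_def)
      with False show ?thesis by blast
    qed
  qed
  with assms(3) that show ?thesis by blast
qed

text \<open>
  A condition \<open>(I, N)\<close> puts the elements of \<open>I\<close> into a set and keeps those of \<open>N\<close> out of it.
\<close>

definition condition :: "nat set \<times> nat set \<Rightarrow> bool" where
  "condition p \<longleftrightarrow> finite (fst p) \<and> finite (snd p) \<and> fst p \<inter> snd p = {}"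

definition extends :: "nat set \<times> nat set \<Rightarrow> nat set \<times> nat set \<Rightarrow> bool" where
  "extends p q \<longleftrightarrow> fst q \<subseteq> fst p \<and> snd q \<subseteq> snd p"

text \<open>All sets \<open>B\<close> compatible with \<open>q\<close> are covered, infinite ones
  included, so the property passes to the limit of a chain of conditions.\<close>

definition forces_diff where
  "forces_diff g f \<Phi> p q \<longleftrightarrow> (\<exists>n\<in>fst p. \<exists>v. f n = Some v \<and>
     (\<forall>B. fst q \<subseteq> B \<longrightarrow> B \<inter> snd q = {} \<longrightarrow>
        run \<Phi> (join g (f |` B)) [n] \<noteq> Some v))"

lemma extends_refl: "extends p p"
  by (simp add: extends_def)

lemma extends_trans: "extends p q \<Longrightarrow> extends q r \<Longrightarrow> extends p r"
  by (auto simp: extends_def)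

text \<open>Extending \<open>q\<close> leaves fewer sets \<open>B\<close> to consider, and extending
  \<open>p\<close> keeps the witness.\<close>

lemma forces_diff_extends:
  assumes "forces_diff g f \<Phi> p q" and "extends p' p" and "extends q' q"
  shows "forces_diff g f \<Phi> p' q'"
proof -
  have "fst q \<subseteq> B \<and> B \<inter> snd q = {}" if "fst q' \<subseteq> B" "B \<inter> snd q' = {}" for B
    using that assms(3) by (auto simp: extends_def)
  with assms(1,2) show ?thesis
    unfolding forces_diff_def extends_def by (metis subsetD)
qed

lemma forces_diff_dense:
  assumes "\<not> f \<le>\<^sub>s\<^sub>u\<^sub>b\<^sub>T g" and "partial_computable \<Phi>" and p: "condition p" and q: "condition q"
  obtains p' q' where "condition p'" and "extends p' p" and "condition q'" and "extends q' q"
    and "forces_diff g f \<Phi> p' q'"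
proof -
  have fin: "finite (fst p \<union> snd p)" "finite (fst q)"
    using p q by (auto simp: condition_def)
  \<comment> \<open>Since \<open>n\<close> avoids \<open>snd p\<close>, it can be added to the
    positive part.\<close>
  obtain n v where n: "n \<notin> fst p \<union> snd p" "f n = Some v"
    and run: "run \<Phi> (join g (f |` fst q)) [n] \<noteq> Some v"
    by (rule fresh_disagreement[OF assms(1,2) fin])
  define p' where "p' = (insert n (fst p), snd p)"
  have p': "condition p'" "extends p' p"
    using p n by (auto simp: p'_def condition_def extends_def)
  show thesis
  \<comment> \<open>If no set containing \<open>fst q\<close> yields the right value,
    \<open>q\<close> already forces the difference; this covers runs that halt with a wrong value.
    Otherwise the blocking query is banned.\<close>
  proof (cases "\<exists>B. fst q \<subseteq> B \<and> run \<Phi> (join g (f |` B)) [n] = Some v")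
    case True
    then obtain B where B: "fst q \<subseteq> B" "run \<Phi> (join g (f |` B)) [n] = Some v"
      by blast
    obtain m where m: "m \<notin> fst q"
      and stuck: "\<And>C. fst q \<subseteq> C \<Longrightarrow> m \<notin> C \<Longrightarrow>
        run \<Phi> (join g (f |` C)) [n] = None"
      using run_blocking_query[OF B run] by blast
    show thesis
    proof (rule that[OF p'])
      show "condition (fst q, insert m (snd q))" "extends (fst q, insert m (snd q)) q"
        using q m by (auto simp: condition_def extends_def)
      show "forces_diff g f \<Phi> p' (fst q, insert m (snd q))"
        using n stuck by (fastforce simp: forces_diff_def p'_def)
    qed
  next
    case False
    show thesis
      by (rule that[OF p' q extends_refl]) (use n False in \<open>auto simp: forces_diff_def p'_def\<close>)
  qed
qed

text \<open>Requirements are met one after another; earlier ones survive by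
  \<open>forces_diff_extends\<close>.\<close>

lemma forces_diff_finitely_many:
  assumes "\<not> f \<le>\<^sub>s\<^sub>u\<^sub>b\<^sub>T g" and "finite R"
    and "\<And>\<Phi> \<sigma> \<tau>. (\<Phi>, \<sigma>, \<tau>) \<in> R \<Longrightarrow> partial_computable \<Phi> \<and> \<sigma> \<noteq> \<tau>"
    and "\<And>\<sigma>. condition (P \<sigma>)"
  shows "\<exists>Q. (\<forall>\<sigma>. condition (Q \<sigma>) \<and> extends (Q \<sigma>) (P \<sigma>)) \<and>
    (\<forall>(\<Phi>, \<sigma>, \<tau>) \<in> R. forces_diff g f \<Phi> (Q \<sigma>) (Q \<tau>))"
  using assms(2,3)
proof (induction R)
  case empty
  then show ?case using assms(4) by (auto intro!: exI[of _ P] extends_refl)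
next
  case (insert r R)
  obtain \<Phi> \<sigma> \<tau> where r: "r = (\<Phi>, \<sigma>, \<tau>)" by (cases r)
  obtain Q where Q: "\<And>\<sigma>. condition (Q \<sigma>)" "\<And>\<sigma>. extends (Q \<sigma>) (P \<sigma>)"
    and forces: "\<And>\<Phi> \<sigma> \<tau>. (\<Phi>, \<sigma>, \<tau>) \<in> R \<Longrightarrow> forces_diff g f \<Phi> (Q \<sigma>) (Q \<tau>)"
    using insert by fastforce
  have \<Phi>: "partial_computable \<Phi>" "\<sigma> \<noteq> \<tau>" using insert.prems r by auto
  obtain p q where pq: "condition p" "extends p (Q \<sigma>)" "condition q" "extends q (Q \<tau>)"
    "forces_diff g f \<Phi> p q"
    using forces_diff_dense[OF assms(1) \<Phi>(1) Q(1) Q(1)] by blast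
  \<comment> \<open>As \<sigma> and \<tau> differ, the second update does not overwrite the
    first.\<close>
  define Q' where "Q' = Q(\<sigma> := p, \<tau> := q)"
  have ext: "extends (Q' \<rho>) (Q \<rho>)" for \<rho>
    using pq by (auto simp: Q'_def extends_refl)
  have "condition (Q' \<rho>) \<and> extends (Q' \<rho>) (P \<rho>)" for \<rho>
    using pq Q ext by (auto simp: Q'_def intro: extends_trans)
  moreover have "forces_diff g f \<Phi> (Q' \<sigma>) (Q' \<tau>)"
    using pq(5) \<Phi>(2) by (simp add: Q'_def)
  moreover have "forces_diff g f \<Psi> (Q' \<mu>) (Q' \<nu>)" if "(\<Psi>, \<mu>, \<nu>) \<in> R" for \<Psi> \<mu> \<nu>
    using forces_diff_extends[OF forces[OF that] ext ext] .
  ultimately show ?case by (auto simp: r intro!: exI[of _ Q'])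
qed

section \<open>Enumerating the functionals\<close>

instance recf :: countable
  by countable_datatype

text \<open>A functional is recovered from any program for it by decoding outputs, and there are
  countably many programs.\<close>

lemma countable_partial_computable: "countable {\<Phi>. partial_computable \<Phi>}"
proof -
  define program where "program r = (\<lambda>xs. map_option decode_action (eval_recf r [list_encode xs]))" for r
  have "\<Phi> \<in> range program" if \<Phi>: "partial_computable \<Phi>" for \<Phi>
  proof -
    obtain r where r: "\<And>xs. eval_recf r [list_encode xs] =
        map_option (\<lambda>(b, q). prod_encode (of_bool b, q)) (\<Phi> xs)"
      using \<Phi> unfolding partial_computable_def by blast
    have "program r = \<Phi>"
      by (auto simp: program_def r fun_eq_iff decode_action_def option.map_comp comp_def
          case_prod_beta intro!: option.map_ident_strong)
    then show ?thesis by blast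
  qed
  then have "{\<Phi>. partial_computable \<Phi>} \<subseteq> range program" by blast
  then show ?thesis by (rule countable_subset) simp
qed

text \<open>Makes the set to be enumerated nonempty; \<open>Proj 1\<close> is undefined on
  one-element lists.\<close>

lemma partial_computable_None: "partial_computable (\<lambda>_. None)"
  unfolding partial_computable_def
  by (rule exI[of _ "Proj 1"]) simp

section \<open>The tree of conditions and its branches\<close>

text \<open>A node of level \<open>n\<close> is a subset of \<open>{..<n}\<close>, standing for a
  binary string of length \<open>n\<close>. Level \<open>Suc n\<close> settles the functionals up to
  index \<open>n\<close> for all pairs of distinct nodes at once.\<close>

lemma condition_tree:
  assumes "\<not> f \<le>\<^sub>s\<^sub>u\<^sub>b\<^sub>T g" and e: "\<And>i. partial_computable (e i)"
  shows "\<exists>P :: nat \<Rightarrow> nat set \<Rightarrow> nat set \<times> nat set. \<forall>n.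
    (\<forall>\<sigma>. condition (P n \<sigma>)) \<and>
    (\<forall>\<sigma>. extends (P (Suc n) \<sigma>) (P n (\<sigma> \<inter> {..<n}))) \<and>
    (\<forall>i\<le>n. \<forall>\<sigma> \<tau>. \<sigma> \<subseteq> {..n} \<longrightarrow> \<tau> \<subseteq> {..n} \<longrightarrow> \<sigma> \<noteq> \<tau> \<longrightarrow>
       forces_diff g f (e i) (P (Suc n) \<sigma>) (P (Suc n) \<tau>))"
proof -
  have step: "\<exists>Q. (\<forall>\<sigma>. condition (Q \<sigma>)) \<and>
      (\<forall>\<sigma>. extends (Q \<sigma>) (P (\<sigma> \<inter> {..<n}))) \<and>
      (\<forall>i\<le>n. \<forall>\<sigma> \<tau>. \<sigma> \<subseteq> {..n} \<longrightarrow> \<tau> \<subseteq> {..n} \<longrightarrow> \<sigma> \<noteq> \<tau> \<longrightarrow>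
         forces_diff g f (e i) (Q \<sigma>) (Q \<tau>))"
    if P: "\<forall>\<sigma>. condition (P \<sigma>)" for n and P :: "nat set \<Rightarrow> nat set \<times> nat set"
  proof -
    \<comment> \<open>The requirements of one level are finite in number: the functionals up to
      index \<open>n\<close> with pairs of distinct nodes.\<close>
    let ?R = "{(\<Phi>, \<sigma>, \<tau>) \<in> e ` {..n} \<times> Pow {..n} \<times> Pow {..n}. \<sigma> \<noteq> \<tau>}"
    have "finite ?R"
      by (rule finite_subset[of _ "e ` {..n} \<times> Pow {..n} \<times> Pow {..n}"]) auto
    then have "\<exists>Q. (\<forall>\<sigma>. condition (Q \<sigma>) \<and> extends (Q \<sigma>) (P (\<sigma> \<inter> {..<n}))) \<and>
        (\<forall>(\<Phi>, \<sigma>, \<tau>) \<in> ?R. forces_diff g f \<Phi> (Q \<sigma>) (Q \<tau>))"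
      using P e by (intro forces_diff_finitely_many[OF assms(1)]) auto
    then obtain Q where "\<And>\<sigma>. condition (Q \<sigma>)" "\<And>\<sigma>. extends (Q \<sigma>) (P (\<sigma> \<inter> {..<n}))"
      and "\<And>\<Phi> \<sigma> \<tau>. (\<Phi>, \<sigma>, \<tau>) \<in> ?R \<Longrightarrow> forces_diff g f \<Phi> (Q \<sigma>) (Q \<tau>)"
      by blast
    then show ?thesis by (intro exI[of _ Q]) auto
  qed
  show ?thesis
    by (rule dependent_nat_choice[OF _ step]) (auto intro!: exI[of _ "\<lambda>_. ({}, {})"] simp: condition_def)
qed

text \<open>Each \<alpha> picks the branch of its initial segments, and \<open>A \<alpha>\<close> is
  the union of the positive parts along it. Distinct branches separate at some level, above which
  every functional is eventually treated.\<close>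

lemma ex_incomparable_restrictions:
  assumes "\<not> f \<le>\<^sub>s\<^sub>u\<^sub>b\<^sub>T g"
  shows "\<exists>A :: nat set \<Rightarrow> nat set. \<forall>\<alpha> \<beta>. \<alpha> \<noteq> \<beta> \<longrightarrow>
    \<not> f |` A \<alpha> \<le>\<^sub>s\<^sub>u\<^sub>b\<^sub>T join g (f |` A \<beta>)"
proof -
  define e where "e = from_nat_into {\<Phi>. partial_computable \<Phi>}"
  have "{\<Phi>. partial_computable \<Phi>} \<noteq> {}" using partial_computable_None by blast
  then have e: "partial_computable (e i)" for i
    using from_nat_into[of "{\<Phi>. partial_computable \<Phi>}" i] by (simp add: e_def)
  obtain P :: "nat \<Rightarrow> nat set \<Rightarrow> nat set \<times> nat set" where tree: "\<forall>n.
      (\<forall>\<sigma>. condition (P n \<sigma>)) \<and>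
      (\<forall>\<sigma>. extends (P (Suc n) \<sigma>) (P n (\<sigma> \<inter> {..<n}))) \<and>
      (\<forall>i\<le>n. \<forall>\<sigma> \<tau>. \<sigma> \<subseteq> {..n} \<longrightarrow> \<tau> \<subseteq> {..n} \<longrightarrow> \<sigma> \<noteq> \<tau> \<longrightarrow>
         forces_diff g f (e i) (P (Suc n) \<sigma>) (P (Suc n) \<tau>))"
    using condition_tree[OF assms e] by (rule exE)
  have P: "condition (P n \<sigma>)" "extends (P (Suc n) \<sigma>) (P n (\<sigma> \<inter> {..<n}))" for n \<sigma>
    using tree by simp_all
  have forces: "forces_diff g f (e i) (P (Suc n) \<sigma>) (P (Suc n) \<tau>)"
    if "i \<le> n" "\<sigma> \<subseteq> {..n}" "\<tau> \<subseteq> {..n}" "\<sigma> \<noteq> \<tau>" for n i \<sigma> \<tau>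
    using tree that by simp
  define c where "c \<alpha> n = P n (\<alpha> \<inter> {..<n})" for \<alpha> n
  have step: "extends (c \<alpha> (Suc n)) (c \<alpha> n)" for \<alpha> n
  proof -
    have "\<alpha> \<inter> {..<Suc n} \<inter> {..<n} = \<alpha> \<inter> {..<n}" by auto
    then show ?thesis using P(2)[of n "\<alpha> \<inter> {..<Suc n}"] by (simp add: c_def)
  qed
  have chain: "extends (c \<alpha> n) (c \<alpha> m)" if "m \<le> n" for \<alpha> m n
    using that
  proof (induction n rule: dec_induct)
    case (step n)
    then show ?case using \<open>\<And>\<alpha> n. extends (c \<alpha> (Suc n)) (c \<alpha> n)\<close> extends_trans by blast
  qed (rule extends_refl)
  define A where "A \<alpha> = (\<Union>n. fst (c \<alpha> n))" for \<alpha>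
  \<comment> \<open>Positive and negative parts from different stages are both contained in the
    condition of the later stage, where they are disjoint.\<close>
  have A_out: "A \<alpha> \<inter> snd (c \<alpha> n) = {}" for \<alpha> n
  proof -
    have "fst (c \<alpha> m) \<inter> snd (c \<alpha> n) = {}" for m
    proof -
      have "extends (c \<alpha> (max m n)) (c \<alpha> m)" "extends (c \<alpha> (max m n)) (c \<alpha> n)"
        by (auto intro: chain)
      moreover have "condition (c \<alpha> (max m n))" using P(1) by (simp add: c_def)
      ultimately show ?thesis unfolding extends_def condition_def by blast
    qed
    then show ?thesis by (auto simp: A_def)
  qed
  have "\<not> f |` A \<alpha> \<le>\<^sub>s\<^sub>u\<^sub>b\<^sub>T join g (f |` A \<beta>)" if "\<alpha> \<noteq> \<beta>" for \<alpha> \<beta>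
  proof
    assume "f |` A \<alpha> \<le>\<^sub>s\<^sub>u\<^sub>b\<^sub>T join g (f |` A \<beta>)"
    then obtain \<Phi> where "partial_computable \<Phi>"
      and le: "f |` A \<alpha> \<subseteq>\<^sub>m seq_computation \<Phi> (join g (f |` A \<beta>))"
      unfolding subT_le_def by blast
    then obtain i where i: "e i = \<Phi>"
      using from_nat_into_surj[OF countable_partial_computable, of \<Phi>] by (auto simp: e_def)
    obtain k where k: "k \<in> \<alpha> \<longleftrightarrow> k \<notin> \<beta>" using \<open>\<alpha> \<noteq> \<beta>\<close> by blast
    \<comment> \<open>Late enough for \<open>e i\<close> to be treated and for \<open>k\<close> to
      lie below \<open>Suc n\<close>, so that the two initial segments differ.\<close>
    define n where "n = max i k"
    have "\<alpha> \<inter> {..<Suc n} \<noteq> \<beta> \<inter> {..<Suc n}"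
      using k by (auto simp: n_def set_eq_iff less_Suc_eq_le intro!: exI[of _ k])
    then have "forces_diff g f \<Phi> (c \<alpha> (Suc n)) (c \<beta> (Suc n))"
      using forces[of i n "\<alpha> \<inter> {..<Suc n}" "\<beta> \<inter> {..<Suc n}"] i
      by (simp add: c_def n_def lessThan_Suc_atMost)
    then obtain m v where m: "m \<in> fst (c \<alpha> (Suc n))" "f m = Some v"
      and diff: "\<And>B. fst (c \<beta> (Suc n)) \<subseteq> B \<Longrightarrow> B \<inter> snd (c \<beta> (Suc n)) = {} \<Longrightarrow>
        run \<Phi> (join g (f |` B)) [m] \<noteq> Some v"
      by (auto simp: forces_diff_def)
    \<comment> \<open>The completed set \<open>A \<beta>\<close> is compatible with every condition
      along its branch, hence an admissible \<open>B\<close>.\<close>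
    have ne: "run \<Phi> (join g (f |` A \<beta>)) [m] \<noteq> Some v"
      by (rule diff[OF _ A_out]) (auto simp: A_def)
    have "m \<in> A \<alpha>" using m(1) by (auto simp: A_def)
    then have "(f |` A \<alpha>) m = Some v" using m(2) by simp
    then have "seq_computation \<Phi> (join g (f |` A \<beta>)) m = Some v"
      using le unfolding map_le_def by (metis domI)
    with ne show False by (simp add: seq_computation_def)
  qed
  then show ?thesis by blast
qed

text \<open>\<open>nat set\<close> has the cardinality of the continuum and indexes the
  family.\<close>

theorem theorem4p4:
  fixes g f :: "nat \<Rightarrow> nat option"
  assumes "g <\<^sub>s\<^sub>u\<^sub>b\<^sub>T f"
  shows "\<exists>h :: nat set \<Rightarrow> (nat \<Rightarrow> nat option).
           (\<forall>\<alpha>. g <\<^sub>s\<^sub>u\<^sub>b\<^sub>T h \<alpha> \<and> h \<alpha> <\<^sub>s\<^sub>u\<^sub>b\<^sub>T f) \<and>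
           (\<forall>\<alpha> \<beta>. \<alpha> \<noteq> \<beta> \<longrightarrow> \<not> h \<alpha> \<le>\<^sub>s\<^sub>u\<^sub>b\<^sub>T h \<beta>)"
proof -
  have g: "g \<le>\<^sub>s\<^sub>u\<^sub>b\<^sub>T f" and nle: "\<not> f \<le>\<^sub>s\<^sub>u\<^sub>b\<^sub>T g"
    using assms by (auto simp: subT_less_def)
  obtain A :: "nat set \<Rightarrow> nat set"
    where A: "\<And>\<alpha> \<beta>. \<alpha> \<noteq> \<beta> \<Longrightarrow> \<not> f |` A \<alpha> \<le>\<^sub>s\<^sub>u\<^sub>b\<^sub>T join g (f |` A \<beta>)"
    using ex_incomparable_restrictions[OF nle] by blast
  have antichain: "\<not> join g (f |` A \<alpha>) \<le>\<^sub>s\<^sub>u\<^sub>b\<^sub>T join g (f |` A \<beta>)" if "\<alpha> \<noteq> \<beta>" for \<alpha> \<beta>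
    using A[OF that] subT_le_join2D by blast
  have "g <\<^sub>s\<^sub>u\<^sub>b\<^sub>T join g (f |` A \<alpha>) \<and> join g (f |` A \<alpha>) <\<^sub>s\<^sub>u\<^sub>b\<^sub>T f" for \<alpha>
  proof -
    \<comment> \<open>The complement serves as a second index. A reduction of the join for \<alpha>
      to \<open>g\<close> would reduce it to the join for the complement; a reduction of
      \<open>f\<close> to the join for \<alpha> would also reduce the other restriction of
      \<open>f\<close> to it.\<close>
    have ne: "\<alpha> \<noteq> - \<alpha>" by blast
    have "\<not> join g (f |` A \<alpha>) \<le>\<^sub>s\<^sub>u\<^sub>b\<^sub>T g"
      using antichain[OF ne] subT_le_join1_trans by blast
    moreover have "\<not> f \<le>\<^sub>s\<^sub>u\<^sub>b\<^sub>T join g (f |` A \<alpha>)"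
      using A[OF ne[symmetric]] map_le_subT_le[of f _ "f |` A (- \<alpha>)"]
      by (auto simp: map_le_def)
    ultimately show ?thesis
      using subT_le_join1 join_restrict_subT_le[OF g] by (simp add: subT_less_def)
  qed
  with antichain show ?thesis
    by (intro exI[of _ "\<lambda>\<alpha>. join g (f |` A \<alpha>)"]) simp
qed

end
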